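(* Let $A,B\subseteq\mathbb{R}\setminus\{0\}$ be finite sets. Then $$|A+B|^3\gg \frac{|B|\,\mathsf{E}^*(A)}{\log|A|}\geq \frac{|A|^4|B|}{|AA^{\pm1}|\log|A|},$$ and $$|B+AA|^3\gg \frac{|B|\,|A|^{12}}{(\mathsf{E}^*_3(A))^2\,|AA^{-1}|\,\log|A|}.$$
   Context: $A+B=\{a+b:a\in A,b\in B\}$, $AA=\{ab:a,b\in A\}$, $AA^{-1}=\{a/b:a,b\in A\}$, and $|AA^{\pm1}|$ denotes either $|AA|$ or $|AA^{-1}|$ (the inequality holds for both); $B+AA=\{b+x:b\in B,x\in AA\}$. The multiplicative energy $\mathsf{E}^*(A)$ is the number of solutions of $a_1a_2=a_3a_4$ with $a_i\in A$. For $x\in\mathbb{R}$ let $r_{A:A}(x)=|\{(a,b)\in A\times A: a/b=x\}|$, and $\mathsf{E}^*_3(A)=\sum_x r_{A:A}(x)^3$. $X\gg Y$ means $X\geq cY$ for an absolute constant $c>0$. Logarithms are base 2. *)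

theory Defs
  imports Complex_Main
begin

definition sumset :: "real set \<Rightarrow> real set \<Rightarrow> real set" where
  "sumset A B = {a + b | a b. a \<in> A \<and> b \<in> B}"

definition prodset :: "real set \<Rightarrow> real set" where
  "prodset A = {a * b | a b. a \<in> A \<and> b \<in> A}"

definition quotset :: "real set \<Rightarrow> real set" where
  "quotset A = {a / b | a b. a \<in> A \<and> b \<in> A}"

definition mult_energy :: "real set \<Rightarrow> nat" where
  "mult_energy A = card {(a1, a2, a3, a4). a1 \<in> A \<and> a2 \<in> A \<and> a3 \<in> A \<and> a4 \<in> A \<and> a1 * a2 = a3 * a4}"

definition r_quot :: "real set \<Rightarrow> real \<Rightarrow> nat" where
  "r_quot A x = card {(a, b). a \<in> A \<and> b \<in> A \<and> a / b = x}"

definition mult_energy3 :: "real set \<Rightarrow> nat" where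
  "mult_energy3 A = (\<Sum>x\<in>quotset A. r_quot A x ^ 3)"

end

(* Let Y = A + B and let S be a set of slopes x with at least t representations x = a / a' in A.
   For x in S and b, b' in B, the line of slope x through (b, b') contains at least t points
   (a' + b, a + b') of the grid Y x Y. Incidences with Cartesian products are bounded
   without the Szemeredi-Trotter theorem: cut a grid U x U into cells of D x D points; a line meets
   O(|U| / D) cells, so a line with many more grid points than that has almost all of them
   in a cell containing another one, and each of the |U|^2 D^2 pairs of points in a common
   cell determines at most one line. Applied to Y x Y this bounds the number of lines; applied to
   B x B it bounds the incidences on lines rich in B x B. Together |S| t^2 |B| << |Y|^3 as soon
   as t |B| >= 2 |Y|, and summing (2 t - 1) |S_t| over t gives the energy with a harmonic sum as
   the logarithm; the small t are covered by t |S_t| <= |A|^2.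
   The last inequality is the first one for A A, since Cauchy-Schwarz for the map
   (a, c, d) |-> (c / d, a c) gives |A|^12 <= E(A A) E_3(A)^2 |A / A|. *)

theory Submission
  imports Defs "HOL-Analysis.Harmonic_Numbers" "HOL-Analysis.Convex"
begin

section \<open>Fibres, collisions and Cauchy-Schwarz\<close>

lemma card_eq_sum_fibres:
  assumes "finite X"
  shows "card X = (\<Sum>y\<in>f ` X. card {s\<in>X. f s = y})"
  using sum.image_gen[OF assms, of "\<lambda>_. 1::nat" f] by simp

lemma card_collisions:
  assumes "finite X"
  shows "card {(s, t). s \<in> X \<and> t \<in> X \<and> f s = f t} = (\<Sum>y\<in>f ` X. card {s\<in>X. f s = y} ^ 2)"
proof -
  have "{(s, t). s \<in> X \<and> t \<in> X \<and> f s = f t}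
      = (\<Union>y\<in>f ` X. {s\<in>X. f s = y} \<times> {s\<in>X. f s = y})" by auto
  also have "card \<dots> = (\<Sum>y\<in>f ` X. card ({s\<in>X. f s = y} \<times> {s\<in>X. f s = y}))"
    using assms by (intro card_UN_disjoint) auto
  finally show ?thesis by (simp add: card_cartesian_product power2_eq_square)
qed

text \<open>Cauchy-Schwarz over the image: the fibre sizes add up to \<open>card X\<close>, and
  their squares add up to the number of colliding pairs.\<close>

lemma card_squared_le_image_times_collisions:
  assumes "finite X"
  shows "card X ^ 2 \<le> card (f ` X) * card {(s, t). s \<in> X \<and> t \<in> X \<and> f s = f t}"
proof -
  have "real (card X) ^ 2 = (\<Sum>y\<in>f ` X. real (card {s\<in>X. f s = y})) ^ 2"
    by (subst card_eq_sum_fibres[OF assms, of f]) simp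
  also have "\<dots> \<le> (\<Sum>y\<in>f ` X. real (card {s\<in>X. f s = y}) ^ 2) * card (f ` X)"
    by (rule sum_squared_le_sum_of_squares)
  also have "\<dots> = real (card (f ` X) * card {(s, t). s \<in> X \<and> t \<in> X \<and> f s = f t})"
    by (simp add: card_collisions[OF assms])
  finally show ?thesis by (simp flip: of_nat_power add: of_nat_le_iff del: of_nat_mult)
qed

section \<open>Product, quotient and sum sets\<close>

lemma prodset_eq_image: "prodset A = (\<lambda>(a, b). a * b) ` (A \<times> A)"
  by (auto simp: prodset_def)

lemma quotset_eq_image: "quotset A = (\<lambda>(a, b). a / b) ` (A \<times> A)"
  by (auto simp: quotset_def)

lemma sumset_eq_image: "sumset A B = (\<lambda>(a, b). a + b) ` (A \<times> B)"
  by (auto simp: sumset_def)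

lemma finite_prodset: "finite A \<Longrightarrow> finite (prodset A)"
  by (simp add: prodset_eq_image)

lemma finite_quotset: "finite A \<Longrightarrow> finite (quotset A)"
  by (simp add: quotset_eq_image)

lemma finite_sumset: "finite A \<Longrightarrow> finite B \<Longrightarrow> finite (sumset A B)"
  by (simp add: sumset_eq_image)

lemma sumset_commute: "sumset A B = sumset B A"
  by (force simp: sumset_def add.commute)

lemma card_le_card_sumset:
  assumes "finite A" "finite B" "B \<noteq> {}"
  shows "card A \<le> card (sumset A B)"
proof -
  obtain b where "b \<in> B" using assms by blast
  then have "(\<lambda>a. a + b) ` A \<subseteq> sumset A B" by (auto simp: sumset_def)
  then show ?thesis
    by (intro card_inj_on_le[of "\<lambda>a. a + b"] finite_sumset assms) (auto simp: inj_on_def)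
qed

section \<open>Multiplicative energy as a collision count\<close>

lemma r_quot_eq: "r_quot A x = card {p\<in>A \<times> A. (\<lambda>(a, b). a / b) p = x}"
  by (auto simp: r_quot_def intro: arg_cong[where f = card])

text \<open>Without zeros, \<open>a1 * a2 = a3 * a4\<close> is the same as
  \<open>a1 / a3 = a4 / a2\<close>.\<close>

lemma mult_energy_eq_quot_collisions:
  assumes "0 \<notin> A"
  shows "mult_energy A = card {(p, q). p \<in> A \<times> A \<and> q \<in> A \<times> A \<and>
           (\<lambda>(a, b). a / b) p = (\<lambda>(a, b). a / b) q}"
proof -
  have nz: "a \<noteq> 0" if "a \<in> A" for a using that assms by auto
  have "bij_betw (\<lambda>(a1, a2, a3, a4). ((a1, a3), (a4, a2)))
     {(a1, a2, a3, a4). a1 \<in> A \<and> a2 \<in> A \<and> a3 \<in> A \<and> a4 \<in> A \<and> a1 * a2 = a3 * a4}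
     {(p, q). p \<in> A \<times> A \<and> q \<in> A \<times> A \<and> (\<lambda>(a, b). a / b) p = (\<lambda>(a, b). a / b) q}"
    by (rule bij_betw_byWitness[where f' = "\<lambda>((a1, a3), (a4, a2)). (a1, a2, a3, a4)"])
      (auto simp: frac_eq_eq nz mult.commute)
  then show ?thesis by (simp add: mult_energy_def bij_betw_same_card)
qed

lemma mult_energy_eq_prod_collisions:
  "mult_energy A = card {(p, q). p \<in> A \<times> A \<and> q \<in> A \<times> A \<and>
     (\<lambda>(a, b). a * b) p = (\<lambda>(a, b). a * b) q}"
proof -
  have "bij_betw (\<lambda>(a1, a2, a3, a4). ((a1, a2), (a3, a4)))
     {(a1, a2, a3, a4). a1 \<in> A \<and> a2 \<in> A \<and> a3 \<in> A \<and> a4 \<in> A \<and> a1 * a2 = a3 * a4}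
     {(p, q). p \<in> A \<times> A \<and> q \<in> A \<times> A \<and> (\<lambda>(a, b). a * b) p = (\<lambda>(a, b). a * b) q}"
    by (rule bij_betw_byWitness[where f' = "\<lambda>((a1, a2), (a3, a4)). (a1, a2, a3, a4)"]) auto
  then show ?thesis by (simp add: mult_energy_def bij_betw_same_card)
qed

lemma mult_energy_eq_sum_r_quot:
  assumes "finite A" "0 \<notin> A"
  shows "mult_energy A = (\<Sum>x\<in>quotset A. r_quot A x ^ 2)"
  unfolding mult_energy_eq_quot_collisions[OF assms(2)] r_quot_eq quotset_eq_image
  by (rule card_collisions) (use assms in simp)

lemma sum_r_quot:
  assumes "finite A"
  shows "(\<Sum>x\<in>quotset A. r_quot A x) = card A ^ 2"
  using card_eq_sum_fibres[of "A \<times> A" "\<lambda>(a, b). a / b"] assms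
  by (simp add: r_quot_eq quotset_eq_image card_cartesian_product power2_eq_square)

lemma card_pow4_le_prodset_energy:
  assumes "finite A"
  shows "card A ^ 4 \<le> card (prodset A) * mult_energy A"
proof -
  have "card A ^ 4 = card (A \<times> A) ^ 2"
    by (simp add: card_cartesian_product power2_eq_square eval_nat_numeral)
  then show ?thesis
    using card_squared_le_image_times_collisions[of "A \<times> A" "\<lambda>(a, b). a * b"] assms
    unfolding mult_energy_eq_prod_collisions prodset_eq_image by simp
qed

lemma card_pow4_le_quotset_energy:
  assumes "finite A" "0 \<notin> A"
  shows "card A ^ 4 \<le> card (quotset A) * mult_energy A"
proof -
  have "card A ^ 4 = card (A \<times> A) ^ 2"
    by (simp add: card_cartesian_product power2_eq_square eval_nat_numeral)
  then show ?thesis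
    using card_squared_le_image_times_collisions[of "A \<times> A" "\<lambda>(a, b). a / b"] assms
    unfolding mult_energy_eq_quot_collisions[OF assms(2)] quotset_eq_image by simp
qed

text \<open>A pair with quotient \<open>x\<close> is determined by its denominator. In this form a
  representation of \<open>x\<close> becomes a point of \<open>A \<times> A\<close> on the line of
  slope \<open>x\<close> through the origin.\<close>

lemma r_quot_le_card:
  assumes "finite A" "0 \<notin> A"
  shows "r_quot A x \<le> card {a\<in>A. x * a \<in> A}"
  unfolding r_quot_def
  by (rule card_inj_on_le[where f = snd]) (use assms in \<open>auto simp: inj_on_def\<close>)

section \<open>From the third energy of A to the energy of A A\<close>

lemma card_pow6_le_mult_energy3:
  assumes "finite A" "0 \<notin> A"
  shows "card A ^ 6 \<le> (\<Sum>x\<in>quotset A. r_quot (prodset A) x) * mult_energy3 A"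
proof -
  \<comment> \<open>Cauchy-Schwarz is applied to \<open>\<phi>\<close> on triples: its image gives
    the first factor of the bound, its collisions give the second.\<close>
  define \<phi> where "\<phi> = (\<lambda>(a, c, d). (c / d, a * c) :: real \<times> real)"
  let ?X = "A \<times> A \<times> A"
  let ?F = "\<lambda>x. {(a, b). a \<in> A \<and> b \<in> A \<and> a / b = x}"
  have finF: "finite (?F x)" for x
    by (rule finite_subset[of _ "A \<times> A"]) (use assms in auto)
  have finG: "finite {(a, b). a \<in> prodset A \<and> b \<in> prodset A \<and> a / b = x}" for x
    by (rule finite_subset[of _ "prodset A \<times> prodset A"]) (use finite_prodset assms in auto)
  \<comment> \<open>A collision means \<open>a' / a = c / c' = d / d'\<close>, that is, three
    representations of one quotient, so collisions inject into the set counted by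
    \<open>mult_energy3\<close>.\<close>
  have "card {(s, t). s \<in> ?X \<and> t \<in> ?X \<and> \<phi> s = \<phi> t} 
      \<le> card (Sigma (quotset A) (\<lambda>x. ?F x \<times> ?F x \<times> ?F x))"
  proof (rule card_inj_on_le)
    let ?g = "\<lambda>((a, c, d), (a', c', d')). (a' / a, (a', a), (c, c'), (d, d'))"
    show "inj_on ?g {(s, t). s \<in> ?X \<and> t \<in> ?X \<and> \<phi> s = \<phi> t}" by (auto simp: inj_on_def)
    show "?g ` {(s, t). s \<in> ?X \<and> t \<in> ?X \<and> \<phi> s = \<phi> t}
        \<subseteq> Sigma (quotset A) (\<lambda>x. ?F x \<times> ?F x \<times> ?F x)"
    proof (clarsimp simp: \<phi>_def)
      fix a c d a' c' d' assume *: "a \<in> A" "c \<in> A" "d \<in> A" "a' \<in> A" "c' \<in> A" "d' \<in> A"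
        "c / d = c' / d'" "a * c = a' * c'"
      then have nz: "a \<noteq> 0" "c \<noteq> 0" "d \<noteq> 0" "c' \<noteq> 0" "d' \<noteq> 0" using assms by auto
      have 1: "c / c' = a' / a" using *(8) nz by (simp add: field_simps)
      have "d / d' = c / c'" using *(7) nz by (simp add: field_simps)
      then show "a' / a \<in> quotset A \<and> c / c' = a' / a \<and> d / d' = a' / a"
        using 1 * by (auto simp: quotset_def)
    qed
    show "finite (Sigma (quotset A) (\<lambda>x. ?F x \<times> ?F x \<times> ?F x))"
      using finF finite_quotset[OF assms(1)] by (intro finite_SigmaI finite_cartesian_product)
  qed
  also have "\<dots> = mult_energy3 A"
    using finF finite_quotset[OF assms(1)]
    by (simp add: mult_energy3_def card_cartesian_product r_quot_def power3_eq_cube mult.assoc)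
  finally have coll: "card {(s, t). s \<in> ?X \<and> t \<in> ?X \<and> \<phi> s = \<phi> t} \<le> mult_energy3 A" .
  \<comment> \<open>A value \<open>(x, p)\<close> of \<open>\<phi>\<close> has
    \<open>x = c / d\<close> and \<open>p = a * c\<close>, hence \<open>p / x = a * d\<close>. So
    \<open>(p, p / x)\<close> represents \<open>x\<close> as a quotient of two elements of
    \<open>prodset A\<close>.\<close>
  have "card (\<phi> ` ?X)
      \<le> card (Sigma (quotset A) (\<lambda>x. {(a, b). a \<in> prodset A \<and> b \<in> prodset A \<and> a / b = x}))"
  proof (rule card_inj_on_le)
    let ?g = "\<lambda>(x, p). (x, (p, p / x)) :: real \<times> real \<times> real"
    show "inj_on ?g (\<phi> ` ?X)" by (rule inj_onI) (simp add: split_def prod_eq_iff)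
    show "?g ` \<phi> ` ?X
        \<subseteq> Sigma (quotset A) (\<lambda>x. {(a, b). a \<in> prodset A \<and> b \<in> prodset A \<and> a / b = x})"
    proof
      fix q assume "q \<in> ?g ` \<phi> ` ?X"
      then obtain a c d where *: "a \<in> A" "c \<in> A" "d \<in> A"
        and q: "q = (c / d, a * c, a * c / (c / d))" by (auto simp: \<phi>_def)
      then have "a \<noteq> 0" "c \<noteq> 0" "d \<noteq> 0" using assms by auto
      then have "a * c / (c / d) = a * d" by simp
      then show "q \<in> Sigma (quotset A) (\<lambda>x. {(a, b). a \<in> prodset A \<and> b \<in> prodset A \<and> a / b = x})"
        using * \<open>a \<noteq> 0\<close> \<open>c \<noteq> 0\<close> by (auto simp: q quotset_def prodset_def)
    qed
    show "finite (Sigma (quotset A) (\<lambda>x. {(a, b). a \<in> prodset A \<and> b \<in> prodset A \<and> a / b = x}))"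
      using finG finite_quotset[OF assms(1)] by (intro finite_SigmaI)
  qed
  also have "\<dots> = (\<Sum>x\<in>quotset A. r_quot (prodset A) x)"
    using finG finite_quotset[OF assms(1)] by (simp add: r_quot_def)
  finally have img: "card (\<phi> ` ?X) \<le> (\<Sum>x\<in>quotset A. r_quot (prodset A) x)" .
  have "card A ^ 6 = card ?X ^ 2"
    by (simp add: card_cartesian_product power2_eq_square eval_nat_numeral)
  also have "\<dots> \<le> card (\<phi> ` ?X) * card {(s, t). s \<in> ?X \<and> t \<in> ?X \<and> \<phi> s = \<phi> t}"
    by (rule card_squared_le_image_times_collisions) (use assms in simp)
  also have "\<dots> \<le> (\<Sum>x\<in>quotset A. r_quot (prodset A) x) * mult_energy3 A"
    by (intro mult_mono img coll) auto
  finally show ?thesis .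
qed

lemma zero_notin_prodset: "0 \<notin> A \<Longrightarrow> 0 \<notin> prodset A"
  by (auto simp: prodset_def)

text \<open>The sixth-power bound is squared, and Cauchy-Schwarz over \<open>quotset A\<close> turns
  the sum of \<open>r_quot (prodset A)\<close> into a sum of squares, which is part of the energy of
  \<open>prodset A\<close>.\<close>

lemma card_pow12_le_energy_prodset:
  assumes "finite A" "0 \<notin> A"
  shows "real (card A) ^ 12
    \<le> real (mult_energy3 A) ^ 2 * real (card (quotset A)) * real (mult_energy (prodset A))"
proof -
  \<comment> \<open>Expanding by a common factor: \<open>a / b = (a * a) / (a * b)\<close>.\<close>
  have sub: "quotset A \<subseteq> quotset (prodset A)"
  proof
    fix x assume "x \<in> quotset A"
    then obtain a b where ab: "a \<in> A" "b \<in> A" "x = a / b" by (auto simp: quotset_def)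
    have "a * a \<in> prodset A" "a * b \<in> prodset A" using ab by (auto simp: prodset_def)
    moreover have "x = (a * a) / (a * b)" using ab assms by auto
    ultimately show "x \<in> quotset (prodset A)" unfolding quotset_def by blast
  qed
  let ?W = "\<Sum>x\<in>quotset A. real (r_quot (prodset A) x)"
  have "real (card A) ^ 6 \<le> real ((\<Sum>x\<in>quotset A. r_quot (prodset A) x) * mult_energy3 A)"
    using card_pow6_le_mult_energy3[OF assms] by (simp flip: of_nat_power add: of_nat_le_iff del: of_nat_mult of_nat_sum)
  then have "(real (card A) ^ 6) ^ 2 \<le> (?W * mult_energy3 A) ^ 2"
    by (intro power_mono) auto
  then have "real (card A) ^ 12 \<le> ?W ^ 2 * mult_energy3 A ^ 2"
    by (simp add: power_mult_distrib flip: power_mult)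
  also have "?W ^ 2 \<le> (\<Sum>x\<in>quotset A. real (r_quot (prodset A) x) ^ 2) * card (quotset A)"
    by (rule sum_squared_le_sum_of_squares)
  also have "(\<Sum>x\<in>quotset A. real (r_quot (prodset A) x) ^ 2)
      \<le> (\<Sum>x\<in>quotset (prodset A). real (r_quot (prodset A) x) ^ 2)"
    by (intro sum_mono2 sub finite_quotset finite_prodset assms) auto
  also have "\<dots> = mult_energy (prodset A)"
    by (simp add: mult_energy_eq_sum_r_quot finite_prodset zero_notin_prodset assms)
  finally show ?thesis by (simp add: mult_right_mono mult_ac)
qed

section \<open>Grid cells, rich lines and rich slopes\<close>

definition rank_in :: "real set \<Rightarrow> real \<Rightarrow> nat" where
  "rank_in U u = card {v\<in>U. v < u}"

lemma rank_in_mono: "finite U \<Longrightarrow> u \<le> v \<Longrightarrow> rank_in U u \<le> rank_in U v"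
  unfolding rank_in_def by (rule card_mono) auto

lemma rank_in_strict_mono:
  assumes "finite U" "u \<in> U" "u < v"
  shows "rank_in U u < rank_in U v"
  unfolding rank_in_def by (rule psubset_card_mono) (use assms in auto)

lemma inj_on_rank_in: "finite U \<Longrightarrow> inj_on (rank_in U) U"
  by (rule inj_onI) (metis rank_in_strict_mono less_irrefl linorder_neqE_linordered_idom)

lemma rank_in_less_card: "finite U \<Longrightarrow> u \<in> U \<Longrightarrow> rank_in U u < card U"
  unfolding rank_in_def by (rule psubset_card_mono) auto

text \<open>Blocks are runs of \<open>D\<close> consecutive elements of \<open>U\<close>, the last
  one possibly shorter. Cutting by rank bounds the size of a block however \<open>U\<close> is
  spaced; defining the block for every real keeps it monotone on the whole line.\<close>

definition block :: "real set \<Rightarrow> nat \<Rightarrow> real \<Rightarrow> nat" where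
  "block U D u = rank_in U u div D"

lemma block_mono: "finite U \<Longrightarrow> u \<le> v \<Longrightarrow> block U D u \<le> block U D v"
  unfolding block_def by (intro div_le_mono rank_in_mono)

lemma block_le: "finite U \<Longrightarrow> u \<in> U \<Longrightarrow> block U D u \<le> (card U - 1) div D"
  using rank_in_less_card[of U u] by (auto simp: block_def intro!: div_le_mono)

lemma card_block_le:
  assumes "finite U" "D > 0"
  shows "card {v\<in>U. block U D v = j} \<le> D"
proof -
  have "card {v\<in>U. block U D v = j} \<le> card {j * D..<j * D + D}"
  proof (rule card_inj_on_le)
    show "inj_on (rank_in U) {v\<in>U. block U D v = j}"
      using inj_on_rank_in[OF assms(1)] by (rule inj_on_subset) auto
    show "rank_in U ` {v\<in>U. block U D v = j} \<subseteq> {j * D..<j * D + D}"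
      using assms(2) by (auto simp: block_def div_times_less_eq_dividend dividend_less_div_times add.commute)
  qed auto
  then show ?thesis by simp
qed

text \<open>With one representative chosen per value of \<open>f\<close>, every other element of
  \<open>T\<close> collides with its representative.\<close>

lemma card_le_image_plus_collisions:
  assumes "finite T"
  shows "card T \<le> card (f ` T) + card {(u, v). u \<in> T \<and> v \<in> T \<and> u \<noteq> v \<and> f u = f v}"
proof -
  define rep where "rep = inv_into T f"
  have rep: "rep (f u) \<in> T" "f (rep (f u)) = f u" if "u \<in> T" for u
    using that by (auto simp: rep_def inv_into_into f_inv_into_f)
  let ?N = "{u\<in>T. u \<noteq> rep (f u)}"
  have "card T \<le> card (rep ` f ` T \<union> ?N)"
    by (rule card_mono) (use assms in auto)
  also have "\<dots> \<le> card (rep ` f ` T) + card ?N" by (rule card_Un_le)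
  also have "card (rep ` f ` T) \<le> card (f ` T)"
    by (rule card_image_le) (use assms in auto)
  also have "card ?N \<le> card {(u, v). u \<in> T \<and> v \<in> T \<and> u \<noteq> v \<and> f u = f v}"
  proof (rule card_inj_on_le)
    show "inj_on (\<lambda>u. (u, rep (f u))) ?N" by (auto simp: inj_on_def)
    show "(\<lambda>u. (u, rep (f u))) ` ?N \<subseteq> {(u, v). u \<in> T \<and> v \<in> T \<and> u \<noteq> v \<and> f u = f v}"
      using rep by auto
    show "finite {(u, v). u \<in> T \<and> v \<in> T \<and> u \<noteq> v \<and> f u = f v}"
      by (rule finite_subset[of _ "T \<times> T"]) (use assms in auto)
  qed
  finally show ?thesis by simp
qed

text \<open>A pair \<open>(x, c)\<close> encodes the line \<open>v = x * u + c\<close>, and its points are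
  identified with their abscissae.\<close>

definition line_pts :: "real set \<Rightarrow> real \<times> real \<Rightarrow> real set" where
  "line_pts U l = {u\<in>U. fst l * u + snd l \<in> U}"

definition cell_pairs :: "real set \<Rightarrow> nat \<Rightarrow> real \<times> real \<Rightarrow> (real \<times> real) set" where
  "cell_pairs U D l = {(u, v). u \<in> line_pts U l \<and> v \<in> line_pts U l \<and> u \<noteq> v \<and>
     block U D u = block U D v \<and>
     block U D (fst l * u + snd l) = block U D (fst l * v + snd l)}"

lemma finite_line_pts: "finite U \<Longrightarrow> finite (line_pts U l)"
  by (simp add: line_pts_def)

lemma finite_cell_pairs: "finite U \<Longrightarrow> finite (cell_pairs U D l)"
  by (rule finite_subset[of _ "U \<times> U"]) (auto simp: cell_pairs_def line_pts_def)

text \<open>A non-vertical, non-horizontal line is a monotone curve, so it meets at most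
  \<open>2 * card U / D + 1\<close> of the \<open>(card U / D)\<^sup>2\<close> cells; along it the cell is
  determined by the sum (or, for negative slope, the difference) of the two block numbers.\<close>

lemma card_line_pts_le:
  assumes "finite U" "D > 0" "fst l \<noteq> 0"
  shows "card (line_pts U l) \<le> 2 * ((card U - 1) div D) + 1 + card (cell_pairs U D l)"
proof -
  let ?T = "line_pts U l"
  let ?y = "\<lambda>u. fst l * u + snd l"
  define M where "M = (card U - 1) div D"
  \<comment> \<open>For negative slope the vertical block number is reflected in \<open>M\<close>.
    In both cases \<open>f\<close> is then nondecreasing along the line, with values from 0 to
    \<open>2 * M\<close>.\<close>
  define f where "f u = int (block U D u) + (if fst l > 0 then int (block U D (?y u))
     else int M - int (block U D (?y u)))" for u
  have le: "block U D u \<le> M" "block U D (?y u) \<le> M" if "u \<in> ?T" for u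
    using that block_le[OF assms(1)] by (auto simp: line_pts_def M_def)
  \<comment> \<open>Both summands of \<open>f\<close> are nondecreasing, so an equal sum forces each
    of them to be equal.\<close>
  have same: "block U D u = block U D v \<and> block U D (?y u) = block U D (?y v)"
    if "u < v" "f u = f v" for u v
  proof -
    have 1: "block U D u \<le> block U D v" using block_mono[OF assms(1)] that by simp
    show ?thesis
    proof (cases "fst l > 0")
      case True
      then have "block U D (?y u) \<le> block U D (?y v)"
        using that by (intro block_mono assms) auto
      then show ?thesis using 1 that True by (auto simp: f_def)
    next
      case False
      then have "block U D (?y v) \<le> block U D (?y u)"
        using that by (intro block_mono assms) (auto simp: mult_le_cancel_left)
      then show ?thesis using 1 that False by (auto simp: f_def)
    qed
  qed
  have "card (f ` ?T) \<le> card {0..2 * int M}"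
    by (rule card_mono) (use le in \<open>force simp: f_def\<close>)+
  then have "card (f ` ?T) \<le> 2 * M + 1" by simp
  moreover have "{(u, v). u \<in> ?T \<and> v \<in> ?T \<and> u \<noteq> v \<and> f u = f v} \<subseteq> cell_pairs U D l"
    using same by (auto simp: cell_pairs_def neq_iff)
  then have "card {(u, v). u \<in> ?T \<and> v \<in> ?T \<and> u \<noteq> v \<and> f u = f v} \<le> card (cell_pairs U D l)"
    by (intro card_mono finite_cell_pairs assms)
  ultimately show ?thesis
    using card_le_image_plus_collisions[OF finite_line_pts[OF assms(1)], of l f]
    by (simp add: M_def)
qed

text \<open>Two distinct points lie on at most one line.\<close>

lemma sum_card_cell_pairs_le:
  assumes "finite U" "finite L" "D > 0"
  shows "(\<Sum>l\<in>L. card (cell_pairs U D l)) \<le> card U ^ 2 * D ^ 2"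
proof -
  let ?B = "\<lambda>u. {v\<in>U. block U D v = block U D u}"
  \<comment> \<open>Pairs of grid points in a common cell: the first point is arbitrary, and the
    second has at most \<open>D * D\<close> choices.\<close>
  let ?Q = "Sigma (U \<times> U) (\<lambda>(u, v). ?B u \<times> ?B v)"
  have finB: "finite (?B u)" for u using assms by simp
  have "(\<Sum>l\<in>L. card (cell_pairs U D l)) = card (Sigma L (cell_pairs U D))"
    using assms finite_cell_pairs by simp
  also have "\<dots> \<le> card ?Q"
  proof (rule card_inj_on_le)
    let ?g = "\<lambda>(l, (u, v)). ((u, fst l * u + snd l), (v, fst l * v + snd l)) :: (real \<times> real) \<times> (real \<times> real)"
    show "inj_on ?g (Sigma L (cell_pairs U D))"
    proof (rule inj_onI, clarsimp simp: cell_pairs_def)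
      fix x c x' c' u v :: real
      assume uv: "u \<noteq> v" and 1: "x * u + c = x' * u + c'" and 2: "x * v + c = x' * v + c'"
      have "(x - x') * (u - v) = 0" using 1 2 by (simp add: algebra_simps)
      then show "x = x' \<and> c = c'" using uv 1 by simp
    qed
    show "?g ` Sigma L (cell_pairs U D) \<subseteq> ?Q"
      by (auto simp: cell_pairs_def line_pts_def)
    show "finite ?Q" using assms(1) finB by (intro finite_SigmaI) auto
  qed
  also have "\<dots> = (\<Sum>(u, v)\<in>U \<times> U. card (?B u) * card (?B v))"
    using assms(1) finB by (simp add: card_cartesian_product split_def)
  also have "\<dots> \<le> (\<Sum>(u, v)\<in>U \<times> U. D * D)"
    using card_block_le[OF assms(1,3)] by (intro sum_mono) (auto intro!: mult_mono)
  also have "\<dots> = card U ^ 2 * D ^ 2"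
    by (simp add: card_cartesian_product power2_eq_square)
  finally show ?thesis .
qed

text \<open>As \<open>card U / D \<le> r / 8\<close> and \<open>1 \<le> r / 2\<close>, the number of
  cells met is at most \<open>r / 4 + r / 2\<close>, three quarters of the points on the line. At
  least a quarter of the points is therefore paid for by \<open>cell_pairs\<close>, whence the
  factor 4.\<close>

lemma sum_rich_line_pts_le:
  fixes r :: real
  assumes U: "finite U" and L: "finite L" and D: "D > 0" and r: "r \<ge> 2" "8 * card U \<le> D * r"
    and slope: "\<And>l. l \<in> L \<Longrightarrow> fst l \<noteq> 0"
    and rich: "\<And>l. l \<in> L \<Longrightarrow> r \<le> card (line_pts U l)"
  shows "(\<Sum>l\<in>L. real (card (line_pts U l))) \<le> 4 * (card U ^ 2 * D ^ 2)"
proof -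
  have "real (card (line_pts U l)) \<le> 4 * real (card (cell_pairs U D l))" if l: "l \<in> L" for l
  proof -
    have "real ((card U - 1) div D) \<le> real (card U - 1) / D" by (rule of_nat_div_le_of_nat)
    also have "\<dots> \<le> card U / D" by (intro divide_right_mono) auto
    also have "\<dots> \<le> r / 8" using r(2) D by (simp add: field_simps)
    finally have "real ((card U - 1) div D) \<le> r / 8" .
    moreover have "real (card (line_pts U l))
        \<le> real (2 * ((card U - 1) div D) + 1 + card (cell_pairs U D l))"
      using card_line_pts_le[OF U D slope[OF l]] by (simp only: of_nat_le_iff)
    ultimately show ?thesis using rich[OF l] r(1) by simp
  qed
  then have "(\<Sum>l\<in>L. real (card (line_pts U l))) \<le> (\<Sum>l\<in>L. 4 * real (card (cell_pairs U D l)))"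
    by (intro sum_mono)
  also have "\<dots> = 4 * real (\<Sum>l\<in>L. card (cell_pairs U D l))"
    by (simp add: sum_distrib_left)
  also have "\<dots> \<le> 4 * real (card U ^ 2 * D ^ 2)"
    using sum_card_cell_pairs_le[OF U L D] by (simp only: of_nat_le_iff mult_le_cancel_left_pos zero_less_numeral)
  finally show ?thesis by simp
qed

text \<open>The triples in \<open>S \<times> B \<times> B\<close> are incidences between
  \<open>B \<times> B\<close> and the lines in \<open>L\<close>. The lines are rich in the sumset
  grid, which bounds \<open>card L\<close>; this in turn bounds the incidences on lines with few
  points of \<open>B \<times> B\<close>. The other lines are rich in \<open>B \<times> B\<close> and
  are counted there.\<close>

lemma card_rich_slopes_le:
  fixes t :: nat
  assumes A: "finite A" "0 \<notin> A" and B: "finite B" "B \<noteq> {}"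
    and S: "finite S" "0 \<notin> S" and rich: "\<And>x. x \<in> S \<Longrightarrow> t \<le> r_quot A x"
    and t: "t \<le> card A" "2 * card (sumset A B) \<le> t * card B"
  shows "real (card S) * real t ^ 2 * real (card B) \<le> 648 * real (card (sumset A B)) ^ 3"
proof (cases "A = {}")
  case True
  then show ?thesis using t by simp
next
  case False
  let ?Y = "sumset A B"
  define Y where "Y = real (card ?Y)"
  define b where "b = real (card B)"
  define T where "T = real t"
  have finY: "finite ?Y" using A B by (simp add: finite_sumset)
  have b0: "b > 0" using B by (simp add: b_def card_gt_0_iff)
  have AY: "real (card A) \<le> Y" using card_le_card_sumset[OF A(1) B] by (simp add: Y_def)
  have bY: "b \<le> Y"
    using card_le_card_sumset[OF B(1) A(1) False] by (simp add: Y_def b_def sumset_commute)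
  have Y0: "Y > 0" using b0 bY by simp
  have TY: "T \<le> Y" using t(1) AY by (simp add: T_def)
  have Tb: "2 * Y \<le> T * b"
    using t(2) by (simp add: T_def Y_def b_def flip: of_nat_mult)
  have T2: "T \<ge> 2"
  proof (rule ccontr)
    assume "\<not> T \<ge> 2"
    then have "T * b < 2 * b" using b0 by simp
    then show False using Tb bY by simp
  qed
  \<comment> \<open>The least block size allowed for richness \<open>T\<close>. Rounding up costs at
    most \<open>1 \<le> Y / T\<close>, so 8 becomes 9, and \<open>4 * 9 ^ 2 = 324\<close>
    below.\<close>
  define D where "D = nat \<lceil>8 * Y / T\<rceil>"
  have D1: "8 * Y / T \<le> D" unfolding D_def by linarith
  have "8 * Y / T > 0" using Y0 T2 by simp
  then have D0: "D > 0" unfolding D_def by linarith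
  have "real D \<le> 8 * Y / T + 1" using \<open>8 * Y / T > 0\<close> unfolding D_def by linarith
  also have "1 \<le> Y / T" using TY T2 by simp
  finally have D2: "real D \<le> 9 * Y / T" by simp
  have "real D ^ 2 \<le> (9 * Y / T) ^ 2" using D2 by (intro power_mono) auto
  then have D3: "real D ^ 2 \<le> 81 * Y ^ 2 / T ^ 2"
    by (simp add: power_divide power_mult_distrib)

  define \<psi> where "\<psi> = (\<lambda>(x, u, v). (x, v - x * u) :: real \<times> real)"
  let ?X = "S \<times> B \<times> B"
  define L where "L = \<psi> ` ?X"
  have finL: "finite L" using S B by (simp add: L_def)
  have slope: "fst l \<noteq> 0" if "l \<in> L" for l using that S by (auto simp: L_def \<psi>_def)
  have richY: "T \<le> card (line_pts ?Y l)" if l: "l \<in> L" for l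
  proof -
    obtain x u v where x: "x \<in> S" "u \<in> B" "v \<in> B" "l = (x, v - x * u)"
      using l by (auto simp: L_def \<psi>_def)
    have "t \<le> card {a\<in>A. x * a \<in> A}"
      using rich[OF x(1)] r_quot_le_card[OF A, of x] by simp
    also have "\<dots> \<le> card (line_pts ?Y l)"
    proof (rule card_inj_on_le)
      show "inj_on (\<lambda>a. a + u) {a\<in>A. x * a \<in> A}" by (auto simp: inj_on_def)
      show "(\<lambda>a. a + u) ` {a\<in>A. x * a \<in> A} \<subseteq> line_pts ?Y l"
      proof clarsimp
        fix a assume a: "a \<in> A" "x * a \<in> A"
        have "x * (a + u) + (v - x * u) = x * a + v" by (simp add: algebra_simps)
        then have "x * (a + u) + (v - x * u) \<in> ?Y" "a + u \<in> ?Y"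
          using a x unfolding sumset_def by blast+
        then show "a + u \<in> line_pts ?Y l" by (simp add: line_pts_def x)
      qed
    qed (simp add: finite_line_pts finY)
    finally show ?thesis by (simp add: T_def)
  qed
  have "real (card L) * T = (\<Sum>l\<in>L. T)" by simp
  also have "\<dots> \<le> (\<Sum>l\<in>L. real (card (line_pts ?Y l)))" by (intro sum_mono richY)
  also have "\<dots> \<le> 4 * (card ?Y ^ 2 * D ^ 2)"
    using D1 T2 by (intro sum_rich_line_pts_le[where r = T] finY finL D0 slope richY)
      (auto simp: Y_def field_simps)
  also have "\<dots> = 4 * (Y ^ 2 * real D ^ 2)" by (simp add: Y_def)
  also have "\<dots> \<le> 4 * (Y ^ 2 * (81 * Y ^ 2 / T ^ 2))"
    by (intro mult_left_mono D3) auto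
  finally have cL: "real (card L) * T \<le> 324 * Y ^ 4 / T ^ 2" by (simp add: power_add[symmetric])

  text \<open>With this threshold the same block size \<open>D\<close> serves both grids, and the lines with fewer
    than \<open>J\<close> points of \<open>B \<times> B\<close> contribute as much as the bound on \<open>card L\<close> allows.\<close>
  define J where "J = b * T / Y"
  have J2: "J \<ge> 2" using Tb Y0 by (simp add: J_def field_simps)
  let ?k = "\<lambda>l. real (card (line_pts B l))"
  let ?L = "{l\<in>L. ?k l \<ge> J}"
  have DJ: "8 * b \<le> D * J"
  proof -
    have "8 * b = (8 * Y / T) * J" using Y0 T2 by (simp add: J_def)
    also have "\<dots> \<le> D * J" using D1 J2 by (intro mult_right_mono) auto
    finally show ?thesis .
  qed
  have "(\<Sum>l\<in>?L. ?k l) \<le> 4 * (card B ^ 2 * D ^ 2)"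
    using J2 DJ by (intro sum_rich_line_pts_le[where r = J] B finL D0)
      (auto simp: b_def finL slope)
  also have "\<dots> = 4 * (b ^ 2 * real D ^ 2)" by (simp add: b_def)
  also have "\<dots> \<le> 4 * (b ^ 2 * (81 * Y ^ 2 / T ^ 2))"
    by (intro mult_left_mono D3) auto
  finally have heavy: "(\<Sum>l\<in>?L. ?k l) \<le> 324 * b ^ 2 * Y ^ 2 / T ^ 2" by simp
  have "(\<Sum>l\<in>L - ?L. ?k l) \<le> (\<Sum>l\<in>L - ?L. J)" by (intro sum_mono) auto
  also have "\<dots> \<le> (\<Sum>l\<in>L. J)" using J2 finL by (intro sum_mono2) auto
  also have "\<dots> = (b / Y) * (real (card L) * T)" by (simp add: J_def)
  also have "\<dots> \<le> (b / Y) * (324 * Y ^ 4 / T ^ 2)"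
    using b0 Y0 by (intro mult_left_mono cL) auto
  also have "\<dots> = 324 * b * Y ^ 3 / T ^ 2" using Y0 by (simp add: field_simps eval_nat_numeral)
  finally have light: "(\<Sum>l\<in>L - ?L. ?k l) \<le> 324 * b * Y ^ 3 / T ^ 2" .

  \<comment> \<open>The line fixes \<open>x\<close>, and then \<open>u\<close> fixes
    \<open>v\<close>: a triple over \<open>l\<close> is a point of \<open>B \<times> B\<close> on
    \<open>l\<close>.\<close>
  have fibre: "card {p\<in>?X. \<psi> p = l} \<le> card (line_pts B l)" for l
  proof (rule card_inj_on_le)
    show "inj_on (\<lambda>(x, u, v). u) {p\<in>?X. \<psi> p = l}" by (auto simp: inj_on_def \<psi>_def)
    show "(\<lambda>(x, u, v). u) ` {p\<in>?X. \<psi> p = l} \<subseteq> line_pts B l"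
      by (auto simp: \<psi>_def line_pts_def)
  qed (simp add: finite_line_pts B)
  have "real (card S) * b ^ 2 = real (card ?X)"
    by (simp add: card_cartesian_product b_def power2_eq_square)
  also have "\<dots> = (\<Sum>l\<in>L. real (card {p\<in>?X. \<psi> p = l}))"
    using card_eq_sum_fibres[of ?X \<psi>] S B by (simp add: L_def del: card_cartesian_product)
  also have "\<dots> \<le> (\<Sum>l\<in>L. ?k l)" using fibre by (intro sum_mono) simp
  also have "\<dots> = (\<Sum>l\<in>L - ?L. ?k l) + (\<Sum>l\<in>?L. ?k l)"
    using finL by (intro sum.subset_diff) auto
  also have "\<dots> \<le> 324 * b * Y ^ 3 / T ^ 2 + 324 * b ^ 2 * Y ^ 2 / T ^ 2"
    by (rule add_mono[OF light heavy])
  \<comment> \<open>By \<open>b \<le> Y\<close> the heavy part is no larger than the bound for the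
    light one, so the total is \<open>2 * 324 = 648\<close>.\<close>
  also have "b ^ 2 * Y ^ 2 \<le> b * Y ^ 3"
  proof -
    have "b * (b * Y ^ 2) \<le> b * (Y * Y ^ 2)" using bY b0 by (intro mult_left_mono mult_right_mono) auto
    then show ?thesis by (simp add: eval_nat_numeral mult_ac)
  qed
  then have "324 * b * Y ^ 3 / T ^ 2 + 324 * b ^ 2 * Y ^ 2 / T ^ 2 \<le> 648 * b * Y ^ 3 / T ^ 2"
    using T2 by (simp add: field_simps)
  finally have "real (card S) * b ^ 2 \<le> 648 * b * Y ^ 3 / T ^ 2" .
  then have "b * (real (card S) * T ^ 2 * b) \<le> b * (648 * Y ^ 3)"
    using T2 by (simp add: field_simps power2_eq_square)
  then show ?thesis using b0 by (simp add: b_def Y_def T_def)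
qed

section \<open>Summation over the richness threshold t\<close>

lemma sum_odd_eq_square: "(\<Sum>t=1..n. 2 * real t - 1) = real n ^ 2"
  by (induction n) (auto simp: power2_eq_square algebra_simps)

text \<open>Each \<open>r_quot A x ^ 2\<close> is written as a sum of odd numbers and the two sums
  are swapped. Thresholds up to \<open>card A\<close> suffice because
  \<open>r_quot A x \<le> card A\<close>.\<close>

lemma mult_energy_eq_sum_rich:
  assumes "finite A" "0 \<notin> A"
  shows "real (mult_energy A)
    = (\<Sum>t=1..card A. (2 * real t - 1) * card {x\<in>quotset A. t \<le> r_quot A x})"
proof -
  have r: "r_quot A x \<le> card A" for x
  proof -
    have "card {a\<in>A. x * a \<in> A} \<le> card A" by (rule card_mono) (use assms in auto)
    then show ?thesis using r_quot_le_card[OF assms, of x] by simp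
  qed
  have "real (mult_energy A) = (\<Sum>x\<in>quotset A. real (r_quot A x) ^ 2)"
    by (simp add: mult_energy_eq_sum_r_quot assms)
  also have "\<dots> = (\<Sum>x\<in>quotset A. \<Sum>t=1..card A. if t \<le> r_quot A x then 2 * real t - 1 else 0)"
  proof (rule sum.cong[OF refl])
    fix x
    have "{t\<in>{1..card A}. t \<le> r_quot A x} = {1..r_quot A x}" using r[of x] by auto
    then show "real (r_quot A x) ^ 2
        = (\<Sum>t=1..card A. if t \<le> r_quot A x then 2 * real t - 1 else 0)"
      by (simp only: sum_odd_eq_square finite_atLeastAtMost flip: sum.inter_filter)
  qed
  also have "\<dots> = (\<Sum>t=1..card A. \<Sum>x\<in>quotset A. if t \<le> r_quot A x then 2 * real t - 1 else 0)"
    by (rule sum.swap)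
  also have "\<dots> = (\<Sum>t=1..card A. (2 * real t - 1) * card {x\<in>quotset A. t \<le> r_quot A x})"
    using finite_quotset[OF assms(1)] by (simp add: mult.commute flip: sum.inter_filter)
  finally show ?thesis .
qed

text \<open>Markov's inequality: the representation counts add up to
  \<open>card A ^ 2\<close>.\<close>

lemma card_rich_quotients_le:
  assumes "finite A"
  shows "t * card {x\<in>quotset A. t \<le> r_quot A x} \<le> card A ^ 2"
proof -
  have "t * card {x\<in>quotset A. t \<le> r_quot A x} = (\<Sum>x\<in>{x\<in>quotset A. t \<le> r_quot A x}. t)" by simp
  also have "\<dots> \<le> (\<Sum>x\<in>{x\<in>quotset A. t \<le> r_quot A x}. r_quot A x)" by (intro sum_mono) auto
  also have "\<dots> \<le> (\<Sum>x\<in>quotset A. r_quot A x)"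
    using finite_quotset[OF assms] by (intro sum_mono2) auto
  finally show ?thesis using sum_r_quot[OF assms] by simp
qed

text \<open>\<open>harm n - ln n\<close> decreases from 1, and for \<open>n \<ge> 2\<close> both 1
  and \<open>ln n\<close> are at most \<open>log 2 n\<close>.\<close>

lemma harm_le_two_log:
  assumes "n \<ge> 2"
  shows "(harm n :: real) \<le> 2 * log 2 n"
proof -
  have "harm n - ln (real n) \<le> harm 1 - ln (real 1)"
    using euler_mascheroni_sequence_decreasing[of 1 n] assms by simp
  then have "harm n \<le> ln (real n) + 1" by (simp add: harm_def)
  moreover have "ln (2::real) \<le> 1" using ln_le_minus_one[of "2::real"] by simp
  then have "ln (real n) \<le> log 2 n"
    using assms by (simp add: log_def field_simps mult_left_le)
  moreover have "1 \<le> log 2 n" using assms by (simp add: le_log_iff)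
  ultimately show ?thesis by simp
qed

text \<open>Thresholds in \<open>?P\<close> contribute \<open>2 * 648\<close> times a harmonic sum,
  hence 2592 with the logarithm. The remaining ones contribute 4; the total is rounded up to
  2600.\<close>

lemma mult_energy_le_sumset:
  assumes A: "finite A" "0 \<notin> A" and B: "finite B" "B \<noteq> {}" and card: "card A \<ge> 2"
  shows "real (card B) * mult_energy A \<le> 2600 * real (card (sumset A B)) ^ 3 * log 2 (card A)"
proof -
  let ?Y = "real (card (sumset A B))"
  let ?b = "real (card B)"
  define N where "N t = real (card {x\<in>quotset A. t \<le> r_quot A x})" for t
  have b0: "?b > 0" using B by (simp add: card_gt_0_iff)
  have AY: "real (card A) \<le> ?Y" using card_le_card_sumset[OF A(1) B] by simp
  have "A \<noteq> {}" using card by auto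
  then have bY: "?b \<le> ?Y"
    using card_le_card_sumset[OF B(1) A(1)] by (simp add: sumset_commute)
  have log1: "1 \<le> log 2 (card A)" using card by (simp add: le_log_iff)
  let ?M = "{1..card A}"
  let ?P = "{t\<in>?M. 2 * card (sumset A B) \<le> t * card B}"
  have tN: "real t * N t \<le> ?Y ^ 2" for t
  proof -
    have "real t * N t \<le> real (card A ^ 2)"
      using card_rich_quotients_le[OF A(1), of t] unfolding N_def
      by (simp only: of_nat_mult[symmetric] of_nat_le_iff)
    also have "\<dots> \<le> ?Y ^ 2" using AY by (simp add: power_mono)
    finally show ?thesis .
  qed
  have large: "?b * (2 * real t * N t) \<le> 1296 * ?Y ^ 3 * inverse (real t)" if t: "t \<in> ?P" for t
  proof -
    have "N t * real t ^ 2 * ?b \<le> 648 * ?Y ^ 3"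
      unfolding N_def
    proof (rule card_rich_slopes_le[OF A B])
      show "0 \<notin> {x\<in>quotset A. t \<le> r_quot A x}" using A(2) by (auto simp: quotset_def)
    qed (use t A in \<open>auto simp: finite_quotset\<close>)
    then show ?thesis using t by (simp add: field_simps power2_eq_square)
  qed
  have "(\<Sum>t\<in>?P. ?b * (2 * real t * N t)) \<le> (\<Sum>t\<in>?P. 1296 * ?Y ^ 3 * inverse (real t))"
    by (intro sum_mono large)
  also have "\<dots> \<le> (\<Sum>t\<in>?M. 1296 * ?Y ^ 3 * inverse (real t))" by (intro sum_mono2) auto
  also have "\<dots> = 1296 * ?Y ^ 3 * harm (card A)" by (simp add: harm_def sum_distrib_left)
  also have "\<dots> \<le> 1296 * ?Y ^ 3 * (2 * log 2 (card A))"
    by (intro mult_left_mono harm_le_two_log card) auto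
  finally have P: "(\<Sum>t\<in>?P. ?b * (2 * real t * N t)) \<le> 2592 * ?Y ^ 3 * log 2 (card A)" by simp
  have "(\<Sum>t\<in>?M - ?P. ?b * (2 * real t * N t)) \<le> (\<Sum>t\<in>?M - ?P. ?b * (2 * ?Y ^ 2))"
    using tN by (intro sum_mono mult_left_mono) (auto simp: mult.assoc)
  also have "\<dots> = (real (card (?M - ?P)) * ?b) * (2 * ?Y ^ 2)" by simp
  also have "\<dots> \<le> (2 * ?Y) * (2 * ?Y ^ 2)"
  proof (intro mult_right_mono)
    define m where "m = card (?M - ?P)"
    \<comment> \<open>The small thresholds all lie in \<open>{1..s}\<close> for their maximum
      \<open>s\<close>, so there are at most \<open>s\<close> of them, and \<open>s\<close> itself
      violates the condition of \<open>?P\<close>.\<close>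
    have "m * card B \<le> 2 * card (sumset A B)"
    proof (cases "?M - ?P = {}")
      case True
      then show ?thesis unfolding m_def by (metis card.empty mult_0 zero_le)
    next
      case False
      define s where "s = Max (?M - ?P)"
      have s: "s \<in> ?M - ?P" unfolding s_def using False by (intro Max_in) auto
      have "?M - ?P \<subseteq> {1..s}"
      proof
        fix t assume t: "t \<in> ?M - ?P"
        then have "t \<le> s" unfolding s_def by (intro Max_ge) auto
        with t show "t \<in> {1..s}" by simp
      qed
      then have "m \<le> s" unfolding m_def by (metis card_atLeastAtMost card_mono diff_Suc_1 finite_atLeastAtMost)
      then have "m * card B \<le> s * card B" by (rule mult_right_mono) simp
      also have "\<dots> \<le> 2 * card (sumset A B)" using s by auto
      finally show ?thesis .
    qed
    then have "real (m * card B) \<le> real (2 * card (sumset A B))" by (simp only: of_nat_le_iff)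
    then show "real (card (?M - ?P)) * ?b \<le> 2 * ?Y"
      by (simp only: m_def of_nat_mult of_nat_numeral)
  qed auto
  also have "\<dots> = 4 * ?Y ^ 3 * 1" by (simp add: eval_nat_numeral)
  also have "\<dots> \<le> 4 * ?Y ^ 3 * log 2 (card A)" using log1 by (intro mult_left_mono) auto
  finally have Q: "(\<Sum>t\<in>?M - ?P. ?b * (2 * real t * N t)) \<le> 4 * ?Y ^ 3 * log 2 (card A)" .
  have "?b * mult_energy A = (\<Sum>t\<in>?M. ?b * ((2 * real t - 1) * N t))"
    by (simp add: mult_energy_eq_sum_rich[OF A] N_def sum_distrib_left)
  also have "\<dots> \<le> (\<Sum>t\<in>?M. ?b * (2 * real t * N t))"
    by (intro sum_mono mult_left_mono mult_right_mono) (auto simp: N_def)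
  also have "\<dots> = (\<Sum>t\<in>?M - ?P. ?b * (2 * real t * N t)) + (\<Sum>t\<in>?P. ?b * (2 * real t * N t))"
    by (intro sum.subset_diff) auto
  also have "\<dots> \<le> 4 * ?Y ^ 3 * log 2 (card A) + 2592 * ?Y ^ 3 * log 2 (card A)"
    by (rule add_mono[OF Q P])
  also have "\<dots> = 2596 * (?Y ^ 3 * log 2 (card A))" by simp
  also have "\<dots> \<le> 2600 * (?Y ^ 3 * log 2 (card A))"
    using log1 by (intro mult_right_mono) auto
  finally show ?thesis by (simp add: mult.assoc)
qed

section \<open>Degenerate cases and the final bounds\<close>

lemma log_card_nonneg: "0 \<le> log 2 (real (card A))"
proof (cases "card A = 0")
  case False
  then have "1 \<le> card A" by simp
  then show ?thesis by simp
qed (simp add: log_def)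

lemma energy_sumset_bound:
  assumes "finite A" "0 \<notin> A" "finite B"
  shows "real (card B) * mult_energy A / log 2 (card A) \<le> 2600 * real (card (sumset A B)) ^ 3"
proof (cases "B = {} \<or> card A < 2")
  case True
  \<comment> \<open>For \<open>card A\<close> equal to 0 or 1 the logarithm is 0
    (\<open>ln 0 = 0\<close>), and division by 0 makes the left side 0.\<close>
  then have "card B = 0 \<or> card A = 0 \<or> card A = 1" by auto
  then show ?thesis by (auto simp: log_def)
next
  case False
  then have "0 < log 2 (card A)" by simp
  then show ?thesis using mult_energy_le_sumset[of A B] assms False by (simp add: field_simps)
qed

text \<open>Here \<open>p\<close> stands for the size of the product set or of the quotient set, so
  one argument serves both signs. For \<open>p = 0\<close> the left side is a division by 0, hence
  0.\<close>

lemma energy_ge_card_pow4_div: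
  assumes "real (card A) ^ 4 \<le> real p * real (mult_energy A)"
  shows "real (card A) ^ 4 * real (card B) / (real p * log 2 (card A))
    \<le> real (card B) * real (mult_energy A) / log 2 (card A)"
proof (cases "p = 0")
  case True
  then show ?thesis by (simp add: log_card_nonneg)
next
  case False
  then have "real (card A) ^ 4 / p \<le> mult_energy A" using assms by (simp add: field_simps)
  then have "(real (card A) ^ 4 / p) * (card B / log 2 (card A))
      \<le> mult_energy A * (card B / log 2 (card A))"
    by (intro mult_right_mono) (auto simp: log_card_nonneg)
  then show ?thesis by (simp add: mult_ac)
qed

text \<open>The energy bound is applied to \<open>prodset A\<close>. Since
  \<open>card (prodset A) \<le> card A ^ 2\<close>, its logarithm is at most twice that of
  \<open>card A\<close>, which doubles 2600.\<close>

lemma sumset_prodset_bound: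
  assumes A: "finite A" "0 \<notin> A" and B: "finite B"
  shows "real (card B) * real (card A) ^ 12 /
      (real (mult_energy3 A) ^ 2 * real (card (quotset A)) * log 2 (card A))
    \<le> 5200 * real (card (sumset B (prodset A))) ^ 3"
proof (cases "card A < 2")
  case True
  then have "card A = 0 \<or> card A = 1" by auto
  then show ?thesis by auto
next
  case False
  let ?E = "real (mult_energy (prodset A))"
  let ?K = "real (mult_energy3 A) ^ 2 * real (card (quotset A))"
  let ?l = "log 2 (card A)"
  have l: "0 < ?l" using False by simp
  have pow: "real (card A) ^ 12 \<le> ?K * ?E" by (rule card_pow12_le_energy_prodset[OF A])
  have "0 < real (card A) ^ 12" using False by simp
  have "?K \<noteq> 0"
  proof
    assume "?K = 0"
    with pow have "real (card A) ^ 12 \<le> 0" by (simp only: mult_zero_left)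
    with \<open>0 < real (card A) ^ 12\<close> show False by linarith
  qed
  moreover have "0 \<le> ?K" by simp
  ultimately have K: "0 < ?K" by linarith
  obtain a where a: "a \<in> A" using False by fastforce
  \<comment> \<open>Multiplication by a fixed nonzero \<open>a\<close> is injective; this makes the
    logarithm for \<open>prodset A\<close> positive.\<close>
  have "card A \<le> card (prodset A)"
    by (rule card_inj_on_le[of "\<lambda>x. x * a"])
      (use a A finite_prodset in \<open>auto simp: inj_on_def prodset_def\<close>)
  then have P: "2 \<le> card (prodset A)" using False by simp
  have "card (prodset A) \<le> card (A \<times> A)"
    unfolding prodset_eq_image by (rule card_image_le) (use A in simp)
  then have "card (prodset A) \<le> card A ^ 2"
    by (simp add: card_cartesian_product power2_eq_square)
  then have "real (card (prodset A)) \<le> real (card A) ^ 2" by (simp flip: of_nat_power)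
  then have "log 2 (card (prodset A)) \<le> log 2 (real (card A) ^ 2)"
    using P False by (subst log_le_cancel_iff) auto
  also have "\<dots> = 2 * ?l" using False by (simp add: log_nat_power)
  finally have lP: "log 2 (card (prodset A)) \<le> 2 * ?l" .
  have lP0: "0 < log 2 (card (prodset A))" using P by simp
  have "real (card B) * real (card A) ^ 12 / (?K * ?l) \<le> real (card B) * (?K * ?E) / (?K * ?l)"
    using l K by (intro divide_right_mono mult_left_mono pow) auto
  also have "\<dots> = real (card B) * ?E / ?l"
  proof -
    have "b * (k * e) / (k * l) = b * e / l" if "k > 0" for b k e l :: real using that by simp
    then show ?thesis using K by blast
  qed
  also have "\<dots> = 2 * (real (card B) * ?E / (2 * ?l))" by simp
  also have "\<dots> \<le> 2 * (real (card B) * ?E / log 2 (card (prodset A)))"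
    using lP lP0 by (intro mult_left_mono divide_left_mono) auto
  also have "\<dots> \<le> 2 * (2600 * real (card (sumset (prodset A) B)) ^ 3)"
    by (intro mult_left_mono energy_sumset_bound finite_prodset zero_notin_prodset A B) auto
  finally show ?thesis by (simp add: sumset_commute)
qed

theorem theorem2p12:
  "\<exists>c>0. \<forall>A B :: real set. finite A \<and> finite B \<and> 0 \<notin> A \<and> 0 \<notin> B \<longrightarrow>
     c * (real (card B) * real (mult_energy A) / log 2 (card A)) \<le> real (card (sumset A B)) ^ 3
   \<and> real (card B) * real (mult_energy A) / log 2 (card A)
       \<ge> real (card A) ^ 4 * real (card B) / (real (card (prodset A)) * log 2 (card A))
   \<and> real (card B) * real (mult_energy A) / log 2 (card A)
       \<ge> real (card A) ^ 4 * real (card B) / (real (card (quotset A)) * log 2 (card A))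
   \<and> c * (real (card B) * real (card A) ^ 12 /
          (real (mult_energy3 A) ^ 2 * real (card (quotset A)) * log 2 (card A)))
       \<le> real (card (sumset B (prodset A))) ^ 3"
\<comment> \<open>The constant is dictated by the second bound, the weaker of the two.\<close>
proof (intro exI[of _ "1 / 5200"] conjI allI impI)
  fix A B :: "real set"
  assume "finite A \<and> finite B \<and> 0 \<notin> A \<and> 0 \<notin> B"
  then have A: "finite A" "0 \<notin> A" and B: "finite B" by auto
  have scale: "1 / 5200 * u \<le> v" if "u \<le> 5200 * v" for u v :: real using that by simp
  have "2600 * real (card (sumset A B)) ^ 3 \<le> 5200 * real (card (sumset A B)) ^ 3" by simp
  then show "1 / 5200 * (real (card B) * real (mult_energy A) / log 2 (card A))
      \<le> real (card (sumset A B)) ^ 3"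
    by (intro scale order_trans[OF energy_sumset_bound[OF A B]])
  show "real (card A) ^ 4 * real (card B) / (real (card (prodset A)) * log 2 (card A))
      \<le> real (card B) * real (mult_energy A) / log 2 (card A)"
    using card_pow4_le_prodset_energy[OF A(1)]
    by (intro energy_ge_card_pow4_div) (simp flip: of_nat_power of_nat_mult)
  show "real (card A) ^ 4 * real (card B) / (real (card (quotset A)) * log 2 (card A))
      \<le> real (card B) * real (mult_energy A) / log 2 (card A)"
    using card_pow4_le_quotset_energy[OF A]
    by (intro energy_ge_card_pow4_div) (simp flip: of_nat_power of_nat_mult)
  show "1 / 5200 * (real (card B) * real (card A) ^ 12 /
      (real (mult_energy3 A) ^ 2 * real (card (quotset A)) * log 2 (card A)))
      \<le> real (card (sumset B (prodset A))) ^ 3"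
    by (rule scale[OF sumset_prodset_bound[OF A B]])
qed simp

end
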